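(* Let $t$ be a positive integer and let $B$ be a $(t+1)$-separable matrix. Then $B$ is $\overline{t}$-separable if and only if $B$ is strongly $t$-separable.
   Context: Let $M\ge n\ge 2$ be integers and let $B$ be a binary ($0$-$1$) matrix of size $n\times M$. Let $\mathcal{F}=\{c_1,\ldots,c_M\}\subseteq\{0,1\}^n$ be the set of column vectors of $B$. The Boolean sum of a set of columns, denoted $\bigvee$, is their coordinatewise OR (that is, the incidence vector of the union of the subsets of $\{1,\ldots,n\}$ that the columns represent). For a positive integer $s$: - $B$ is called $s$-separable (an $s$-SM) if the Boolean sums of $s$ column vectors of $B$ are all distinct. - $B$ is called $\overline{s}$-separable if the Boolean sums of $\le s$ column vectors of $B$ are all distinct. - $B$ is called strongly $s$-separable if for any $\mathcal{F}_0\subseteq\mathcal{F}$ with $|\mathcal{F}_0|=s$ we have $\bigcap_{\mathcal{F}'\in\mathcal{U}(\mathcal{F}_0)}\mathcal{F}'=\mathcal{F}_0$, where $\mathcal{U}(\mathcal{F}_0)=\{\mathcal{F}'\subseteq\mathcal{F}:\ \bigvee_{c\in\mathcal{F}_0}c=\bigvee_{c\in\mathcal{F}'}c\}$.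
   Formalization: Assumes that t is at most the number of distinct columns of B: for larger t the claim can fail (columns e1, e2, e1+e2 with t = 4); the empty set counts among the sets of at most t columns. *)

theory Defs
  imports "Jordan_Normal_Form.Matrix"
begin

text \<open>
  Binary matrices are matrices over \<^typ>\<open>bool\<close> (\<open>True\<close> for 1, \<open>False\<close> for 0). All notions
  below refer to the \<^emph>\<open>set\<close> of column vectors, so a repeated column counts once.
\<close>

definition columns :: "bool mat \<Rightarrow> bool vec set" where
  "columns B = set (cols B)"

text \<open>The Boolean sum of the empty set of columns is the zero vector (the empty union).\<close>

definition bool_sum :: "nat \<Rightarrow> bool vec set \<Rightarrow> bool vec" where
  "bool_sum n S = vec n (\<lambda>i. \<exists>c\<in>S. c $ i)"

definition separable :: "nat \<Rightarrow> bool mat \<Rightarrow> bool" where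
  "separable s B \<longleftrightarrow>
     inj_on (bool_sum (dim_row B)) {S. S \<subseteq> columns B \<and> card S = s}"

text \<open>
  \<open>bar_separable s\<close> is \<open>s\<close>-bar separability. The empty set of columns is one of the
  competing sets, just as it is in \<open>same_sum_sets\<close> below.
\<close>

definition bar_separable :: "nat \<Rightarrow> bool mat \<Rightarrow> bool" where
  "bar_separable s B \<longleftrightarrow>
     inj_on (bool_sum (dim_row B)) {S. S \<subseteq> columns B \<and> card S \<le> s}"

definition same_sum_sets :: "bool mat \<Rightarrow> bool vec set \<Rightarrow> bool vec set set" where
  "same_sum_sets B F0 =
     {F'. F' \<subseteq> columns B \<and> bool_sum (dim_row B) F0 = bool_sum (dim_row B) F'}"

definition strongly_separable :: "nat \<Rightarrow> bool mat \<Rightarrow> bool" where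
  "strongly_separable s B \<longleftrightarrow>
     (\<forall>F0. F0 \<subseteq> columns B \<and> card F0 = s \<longrightarrow> \<Inter> (same_sum_sets B F0) = F0)"

end

theory Submission imports Defs begin

text \<open>
  Strong \<open>t\<close>-separability says that a set of \<open>t\<close> columns is contained in every set of columns with
  the same Boolean sum (\<open>strongly_separable_iff\<close>).

  If two distinct sets \<open>S\<close> and \<open>S'\<close> of at most \<open>t\<close> columns had the same sum, some column \<open>x\<close> would
  lie in one of them only, say in \<open>S\<close>. Padding \<open>S\<close> to a set of \<open>t\<close> columns and then exchanging \<open>S\<close>
  for \<open>S'\<close> keeps the sum and loses \<open>x\<close>, so strong separability fails
  (\<open>strongly_separable_imp_bar_separable\<close>).

  Conversely, let \<open>F0\<close> have \<open>t\<close> columns and let \<open>F'\<close> have the same sum. If \<open>F'\<close> has at most \<open>t\<close>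
  columns, \<open>t\<close>-bar separability gives \<open>F' = F0\<close>. If it has more, then \<open>(t + 1)\<close>-separability
  enters: adding to \<open>F0\<close> any one column of \<open>F'\<close> does not change the sum, so \<open>F'\<close> has at most one
  column outside \<open>F0\<close>, and by counting it contains all of \<open>F0\<close>.
\<close>

lemma bool_sum_eq_iff:
  "bool_sum n S = bool_sum n S' \<longleftrightarrow> (\<forall>i<n. (\<exists>c\<in>S. c $ i) \<longleftrightarrow> (\<exists>c\<in>S'. c $ i))"
  by (auto simp: bool_sum_def vec_eq_iff)

lemma bool_sum_Un_cong:
  assumes "bool_sum n S = bool_sum n S'"
  shows "bool_sum n (S \<union> T) = bool_sum n (S' \<union> T)"
  using assms by (simp add: bool_sum_eq_iff bex_Un)

lemma bool_sum_insert_absorb: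
  assumes "bool_sum n S = bool_sum n S'" and "y \<in> S'"
  shows "bool_sum n (insert y S) = bool_sum n S"
  using assms unfolding bool_sum_eq_iff by blast

lemma finite_columns: "finite (columns B)"
  by (simp add: columns_def)

text \<open>
  Since \<open>F0\<close> itself belongs to \<open>same_sum_sets B F0\<close>, the intersection of that family can only
  differ from \<open>F0\<close> by being too small.
\<close>

lemma strongly_separable_iff:
  "strongly_separable s B \<longleftrightarrow>
     (\<forall>F0 F'. F0 \<subseteq> columns B \<and> card F0 = s \<and> F' \<subseteq> columns B \<and>
        bool_sum (dim_row B) F0 = bool_sum (dim_row B) F' \<longrightarrow> F0 \<subseteq> F')"
  unfolding strongly_separable_def same_sum_sets_def by blast

text \<open>
  The hypothesis on \<open>t\<close> provides enough columns for the padding. Padding and exchanging shows that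
  either of two small sets with the same sum is contained in the other.
\<close>

lemma strongly_separable_imp_bar_separable:
  assumes strong: "strongly_separable t B" and t: "t \<le> card (columns B)"
  shows "bar_separable t B"
proof -
  have sub: "S \<subseteq> S'"
    if S: "S \<subseteq> columns B" "card S \<le> t" and S': "S' \<subseteq> columns B"
      and eq: "bool_sum (dim_row B) S = bool_sum (dim_row B) S'" for S S'
  proof -
    obtain F0 where F0: "S \<subseteq> F0" "F0 \<subseteq> columns B" "card F0 = t"
      using exists_subset_between[OF S(2) t S(1) finite_columns] by blast
    have "bool_sum (dim_row B) (S \<union> (F0 - S)) = bool_sum (dim_row B) (S' \<union> (F0 - S))"
      by (rule bool_sum_Un_cong[OF eq])
    moreover have "S \<union> (F0 - S) = F0"
      using F0(1) by blast
    ultimately have "F0 \<subseteq> S' \<union> (F0 - S)"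
      using strong F0 S' unfolding strongly_separable_iff
      by (metis Diff_subset Un_least order_trans)
    then show ?thesis
      using F0(1) by blast
  qed
  show ?thesis
    unfolding bar_separable_def
  proof (rule inj_onI)
    fix S S'
    assume "S \<in> {S. S \<subseteq> columns B \<and> card S \<le> t}" "S' \<in> {S. S \<subseteq> columns B \<and> card S \<le> t}"
      "bool_sum (dim_row B) S = bool_sum (dim_row B) S'"
    then show "S = S'"
      using sub[of S S'] sub[of S' S] by auto
  qed
qed

text \<open>
  Otherwise \<open>insert y F0\<close> and \<open>insert z F0\<close> would be distinct sets of \<open>t + 1\<close> columns whose sums
  both equal that of \<open>F0\<close>.
\<close>

lemma separable_Suc_same_sum_unique:
  assumes sep: "separable (Suc t) B"
    and F0: "F0 \<subseteq> columns B" "card F0 = t" and F': "F' \<subseteq> columns B"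
    and eq: "bool_sum (dim_row B) F0 = bool_sum (dim_row B) F'"
    and y: "y \<in> F' - F0" and z: "z \<in> F' - F0"
  shows "y = z"
proof -
  have fin: "finite F0"
    using F0(1) finite_columns by (rule finite_subset)
  have "bool_sum (dim_row B) (insert y F0) = bool_sum (dim_row B) (insert z F0)"
    using bool_sum_insert_absorb[OF eq] y z by simp
  moreover have "insert y F0 \<subseteq> columns B" "insert z F0 \<subseteq> columns B"
      "card (insert y F0) = Suc t" "card (insert z F0) = Suc t"
    using F0 F' y z fin by auto
  ultimately have "insert y F0 = insert z F0"
    using sep unfolding separable_def inj_on_def by blast
  then show ?thesis
    using y z by blast
qed

lemma bar_separable_imp_strongly_separable:
  assumes sep: "separable (Suc t) B" and bar: "bar_separable t B"
  shows "strongly_separable t B"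
  unfolding strongly_separable_iff
proof (intro allI impI, elim conjE)
  fix F0 F'
  assume F0: "F0 \<subseteq> columns B" "card F0 = t" and F': "F' \<subseteq> columns B"
    and eq: "bool_sum (dim_row B) F0 = bool_sum (dim_row B) F'"
  have fin: "finite F0" "finite F'"
    using F0(1) F' finite_columns by (auto intro: finite_subset)
  show "F0 \<subseteq> F'"
  proof (cases "card F' \<le> t")
    case True
    then have "F0 = F'"
      using bar eq F0 F' unfolding bar_separable_def inj_on_def by simp
    then show ?thesis by simp
  next
    case False
    have "card (F' - F0) \<le> Suc 0"
      using separable_Suc_same_sum_unique[OF sep F0 F' eq] fin
      by (simp add: card_le_Suc0_iff_eq)
    moreover have "card F' = card (F' - F0) + card (F0 \<inter> F')"
      using card_Diff_subset_Int[of F' F0] card_mono[of F' "F' \<inter> F0"] fin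
      by (simp add: Int_commute)
    ultimately have "card F0 \<le> card (F0 \<inter> F')"
      using False F0(2) by simp
    then have "F0 \<inter> F' = F0"
      using card_seteq[OF fin(1)] by blast
    then show ?thesis by blast
  qed
qed

theorem theoremI3:
  fixes n M t :: nat and B :: "bool mat"
  assumes "2 \<le> n" and "n \<le> M"
    and "B \<in> carrier_mat n M"
    and "1 \<le> t" and "t \<le> card (columns B)"
    and "separable (t + 1) B"
  shows "bar_separable t B \<longleftrightarrow> strongly_separable t B"
  using assms bar_separable_imp_strongly_separable strongly_separable_imp_bar_separable
  by auto

end
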